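(* Let $m,n\ge 2$ and let $K\subseteq\mathbb{R}^m$ and $K'\subseteq\mathbb{R}^n$ be convex sets with nonempty interior. A map $f\colon K\to K'$ is an isomorphism of $\mathcal{L}_{\mathrm{aff}}$-structures if and only if $m=n$ and $f$ is the restriction to $K$ of an affine bijection $F\colon\mathbb{R}^n\to\mathbb{R}^n$ with $F(K)=K'$. In particular, $K$ and $K'$ are isomorphic as $\mathcal{L}_{\mathrm{aff}}$-structures if and only if they are affinely equivalent.
   Context: $\mathcal{L}_{\mathrm{aff}}$ is the first-order language (with equality) having one ternary relation symbol $B$ and one binary function symbol $C_\lambda$ for each real $\lambda\in[0,1]$. A convex set $K\subseteq\mathbb{R}^n$ is regarded as an $\mathcal{L}_{\mathrm{aff}}$-structure with universe $K$, where $C_\lambda(p,q)=(1-\lambda)p+\lambda q$ and $B(a,x,b)$ holds iff $x\in[a,b]$ (the closed segment). Two convex sets are affinely equivalent if they lie in the same $\mathbb{R}^n$ and some affine bijection of $\mathbb{R}^n$ maps one onto the other. *)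

theory Defs
  imports "HOL-Analysis.Analysis"
begin

text \<open>
  Structures for the first-order language with one ternary relation symbol and one binary
  function symbol for each real in \<open>[0,1]\<close>. The field \<open>Comb\<close> is total in its real argument, but
  only its values on \<open>{0..1}\<close> interpret function symbols, and homomorphism conditions refer
  only to those.
\<close>

record 'a aff_structure =
  Univ :: "'a set"
  Betw :: "'a \<Rightarrow> 'a \<Rightarrow> 'a \<Rightarrow> bool"
  Comb :: "real \<Rightarrow> 'a \<Rightarrow> 'a \<Rightarrow> 'a"

definition aff_isomorphism :: "'a aff_structure \<Rightarrow> 'b aff_structure \<Rightarrow> ('a \<Rightarrow> 'b) \<Rightarrow> bool" where
  "aff_isomorphism M N f \<longleftrightarrow>
     bij_betw f (Univ M) (Univ N) \<and>
     (\<forall>a\<in>Univ M. \<forall>x\<in>Univ M. \<forall>b\<in>Univ M. Betw M a x b \<longleftrightarrow> Betw N (f a) (f x) (f b)) \<and>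
     (\<forall>l\<in>{0..1}. \<forall>p\<in>Univ M. \<forall>q\<in>Univ M. f (Comb M l p q) = Comb N l (f p) (f q))"

definition aff_isomorphic :: "'a aff_structure \<Rightarrow> 'b aff_structure \<Rightarrow> bool" where
  "aff_isomorphic M N \<longleftrightarrow> (\<exists>f. aff_isomorphism M N f)"

definition convex_structure :: "'a::real_vector set \<Rightarrow> 'a aff_structure" where
  "convex_structure K =
     \<lparr> Univ = K,
       Betw = (\<lambda>a x b. x \<in> closed_segment a b),
       Comb = (\<lambda>l p q. (1 - l) *\<^sub>R p + l *\<^sub>R q) \<rparr>"

definition affine_bijection :: "('a::real_vector \<Rightarrow> 'b::real_vector) \<Rightarrow> bool" where
  "affine_bijection F \<longleftrightarrow> bij F \<and> (\<exists>L c. linear L \<and> (\<forall>x. F x = L x + c))"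

text \<open>
  The dimension of the ambient space is carried by the index type, so \<open>m = n\<close> reads
  \<open>CARD('m) = CARD('n)\<close>, and an affine self-bijection of the common space is a map between
  \<open>real ^ 'm\<close> and \<open>real ^ 'n\<close>. When the index types coincide this is literally a map from
  \<open>real ^ 'n\<close> to itself.
\<close>

definition affinely_equivalent :: "(real ^ 'm) set \<Rightarrow> (real ^ 'n) set \<Rightarrow> bool" where
  "affinely_equivalent K K' \<longleftrightarrow>
     CARD('m) = CARD('n) \<and>
     (\<exists>F :: real ^ 'm \<Rightarrow> real ^ 'n. affine_bijection F \<and> F ` K = K')"

end

theory Submission
  imports Defs
begin

text \<open>
  A map preserving convex combinations on \<open>K\<close> becomes, after translating an interior point of
  \<open>K\<close> to the origin, homogeneous for factors in \<open>[0,1]\<close> and midpoint-additive. Its difference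
  quotients \<open>g (s v) / s\<close> therefore do not depend on \<open>s > 0\<close> and define a linear map. That map is
  injective because it is so on a ball, and surjective because its range contains a ball.
  Only \<open>Comb\<close> enters here: a bijection preserving \<open>Comb\<close> preserves \<open>Betw\<close> in both directions.
\<close>

lemma homogeneous_extension:
  fixes g :: "'a::real_normed_vector \<Rightarrow> 'b::real_vector"
  assumes r: "r > 0" and ball: "ball 0 r \<subseteq> U"
    and "g 0 = 0"
    and comb: "\<And>l u v. 0 \<le> l \<Longrightarrow> l \<le> 1 \<Longrightarrow> u \<in> U \<Longrightarrow> v \<in> U \<Longrightarrow>
      g ((1 - l) *\<^sub>R u + l *\<^sub>R v) = (1 - l) *\<^sub>R g u + l *\<^sub>R g v"
  obtains L where "linear L" "\<And>v. v \<in> U \<Longrightarrow> g v = L v"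
proof -
  have "0 \<in> U" using r ball by auto
  then have scale: "g (t *\<^sub>R v) = t *\<^sub>R g v" if "0 \<le> t" "t \<le> 1" "v \<in> U" for t v
    using comb[of t 0 v] that \<open>g 0 = 0\<close> by simp
  have mid: "g ((1/2) *\<^sub>R u + (1/2) *\<^sub>R v) = (1/2) *\<^sub>R g u + (1/2) *\<^sub>R g v"
    if "u \<in> U" "v \<in> U" for u v
    using comb[of "1/2" u v] that by simp
  \<comment> \<open>Every positive factor up to \<open>q v\<close> shrinks \<open>v\<close> into
    \<open>ball 0 r\<close>. The summand 1 keeps the denominator positive at \<open>v = 0\<close>
    and makes the norm bound strict.\<close>
  define q where "q v = r / (1 + norm v)" for v :: 'a
  have q_pos: "q v > 0" for v
    using r by (simp add: q_def add_pos_nonneg)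
  have q_mem: "s *\<^sub>R v \<in> U" if "0 < s" "s \<le> q v" for s v
  proof -
    have "s * (1 + norm v) \<le> r"
      using that by (simp add: q_def pos_le_divide_eq add_pos_nonneg)
    then have "norm (s *\<^sub>R v) < r"
      using that by (simp add: distrib_left)
    then show ?thesis using ball by auto
  qed
  \<comment> \<open>Since \<open>s / t\<close> lies in \<open>[0,1]\<close>, homogeneity at the
    point \<open>t *\<^sub>R v\<close> of \<open>U\<close> relates the two quotients.\<close>
  have le_indep: "(1/s) *\<^sub>R g (s *\<^sub>R v) = (1/t) *\<^sub>R g (t *\<^sub>R v)"
    if "0 < s" "s \<le> t" "t *\<^sub>R v \<in> U" for s t v
    using scale[of "s / t" "t *\<^sub>R v"] that by simp
  have indep: "(1/s) *\<^sub>R g (s *\<^sub>R v) = (1/t) *\<^sub>R g (t *\<^sub>R v)"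
    if "0 < s" "0 < t" "s *\<^sub>R v \<in> U" "t *\<^sub>R v \<in> U" for s t v
    \<comment> \<open>The fact \<open>linear\<close> is totality of the order here, not linearity of
      a map; it decides which of \<open>s\<close> and \<open>t\<close> is the smaller one.\<close>
    using le_indep[OF that(1) _ that(4)] le_indep[OF that(2) _ that(3)] linear[of s t] by argo
  define L where "L v = (1 / q v) *\<^sub>R g (q v *\<^sub>R v)" for v
  \<comment> \<open>The point \<open>s *\<^sub>R v\<close> may be anywhere in \<open>U\<close>, also
    outside the ball. With \<open>s = 1\<close> this later gives \<open>g = L\<close> on all of
    \<open>U\<close>.\<close>
  have L_eq: "g (s *\<^sub>R v) = s *\<^sub>R L v" if "0 < s" "s *\<^sub>R v \<in> U" for s v
  proof -
    have "L v = (1/s) *\<^sub>R g (s *\<^sub>R v)"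
      unfolding L_def using that q_pos[of v] by (intro indep) (auto intro: q_mem)
    then show ?thesis using that by simp
  qed
  have L_add: "L (u + v) = L u + L v" for u v
  proof -
    \<comment> \<open>The sum \<open>s *\<^sub>R (u + v)\<close> is the midpoint of
      \<open>(2 * s) *\<^sub>R u\<close> and \<open>(2 * s) *\<^sub>R v\<close>, so the doubled
      factors have to fit below \<open>q u\<close> and \<open>q v\<close>.\<close>
    define s where "s = Min {q u / 2, q v / 2, q (u + v)}"
    have s: "s > 0" "2 * s \<le> q u" "2 * s \<le> q v" "s \<le> q (u + v)"
      using q_pos[of u] q_pos[of v] q_pos[of "u + v"] by (auto simp: s_def)
    have "s *\<^sub>R L (u + v) = g (s *\<^sub>R (u + v))"
      using s q_mem by (simp add: L_eq)
    also have "s *\<^sub>R (u + v) = (1/2) *\<^sub>R ((2 * s) *\<^sub>R u) + (1/2) *\<^sub>R ((2 * s) *\<^sub>R v)"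
      by (simp add: scaleR_add_right)
    also have "g \<dots> = (1/2) *\<^sub>R g ((2 * s) *\<^sub>R u) + (1/2) *\<^sub>R g ((2 * s) *\<^sub>R v)"
      using s by (intro mid q_mem) auto
    also have "\<dots> = s *\<^sub>R (L u + L v)"
      using s q_mem[of "2 * s"] by (simp add: L_eq scaleR_add_right)
    finally show ?thesis using s by simp
  qed
  have L_pos: "L (c *\<^sub>R v) = c *\<^sub>R L v" if "c > 0" for c v
  proof -
    \<comment> \<open>One point of \<open>U\<close> is read both as a multiple of
      \<open>c *\<^sub>R v\<close> and as a multiple of \<open>v\<close>; comparing the two values
      of \<open>g\<close> there gives the claim.\<close>
    have *: "q (c *\<^sub>R v) *\<^sub>R (c *\<^sub>R v) \<in> U"
      using q_mem q_pos by blast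
    then have "q (c *\<^sub>R v) *\<^sub>R L (c *\<^sub>R v) = (q (c *\<^sub>R v) * c) *\<^sub>R L v"
      using L_eq[of "q (c *\<^sub>R v)" "c *\<^sub>R v"] L_eq[of "q (c *\<^sub>R v) * c" v] q_pos[of "c *\<^sub>R v"] that
      by simp
    then show ?thesis
      using q_pos[of "c *\<^sub>R v"] by (simp flip: scaleR_scaleR)
  qed
  have L_0: "L 0 = 0"
    using L_add[of 0 0] by simp
  have L_minus: "L (- v) = - L v" for v
    using L_add[of v "- v"] L_0 by (simp add: eq_neg_iff_add_eq_0 add.commute)
  have "L (c *\<^sub>R v) = c *\<^sub>R L v" for c v
    using L_pos[of c v] L_pos[of "- c" v] L_minus[of "c *\<^sub>R v"] L_0
    by (cases c "0::real" rule: linorder_cases) auto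
  with L_add have "linear L" by (intro linearI)
  moreover have "g v = L v" if "v \<in> U" for v
    using L_eq[of 1 v] that by simp
  ultimately show ?thesis using that by blast
qed

text \<open>The weights \<open>1 - l\<close> and \<open>l\<close> sum to 1, so moving an interior
  point \<open>a\<close> and its image \<open>f a\<close> to the origins keeps the combination law.
  The linear extension of the translated map then gives the constant
  \<open>f a - L a\<close>.\<close>

lemma convex_combination_map_affine:
  fixes f :: "'a::real_normed_vector \<Rightarrow> 'b::real_vector"
  assumes "interior K \<noteq> {}"
    and comb: "\<And>l p q. 0 \<le> l \<Longrightarrow> l \<le> 1 \<Longrightarrow> p \<in> K \<Longrightarrow> q \<in> K \<Longrightarrow>
      f ((1 - l) *\<^sub>R p + l *\<^sub>R q) = (1 - l) *\<^sub>R f p + l *\<^sub>R f q"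
  obtains L c where "linear L" "\<And>x. x \<in> K \<Longrightarrow> f x = L x + c"
proof -
  obtain a r where r: "r > 0" "ball a r \<subseteq> K"
    using assms(1) by (auto simp: mem_interior)
  then have a: "a \<in> K" by auto
  define U where "U = (\<lambda>x. x - a) ` K"
  have U_iff: "v \<in> U \<longleftrightarrow> a + v \<in> K" for v
    by (auto simp: U_def intro: image_eqI[where x = "a + v"])
  define g where "g v = f (a + v) - f a" for v
  have "ball 0 r \<subseteq> U"
    using r(2) by (auto simp: U_iff subset_iff dist_norm)
  moreover have "g 0 = 0" by (simp add: g_def)
  moreover have "g ((1 - l) *\<^sub>R u + l *\<^sub>R v) = (1 - l) *\<^sub>R g u + l *\<^sub>R g v"
    if "0 \<le> l" "l \<le> 1" "u \<in> U" "v \<in> U" for l u v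
  proof -
    have "a + ((1 - l) *\<^sub>R u + l *\<^sub>R v) = (1 - l) *\<^sub>R (a + u) + l *\<^sub>R (a + v)"
      by (simp add: algebra_simps)
    then have "f (a + ((1 - l) *\<^sub>R u + l *\<^sub>R v)) = (1 - l) *\<^sub>R f (a + u) + l *\<^sub>R f (a + v)"
      using comb that by (simp add: U_iff)
    then show ?thesis
      by (simp add: g_def algebra_simps)
  qed
  ultimately obtain L where L: "linear L" "\<And>v. v \<in> U \<Longrightarrow> g v = L v"
    using homogeneous_extension[OF r(1)] by metis
  have "f x = L x + (f a - L a)" if "x \<in> K" for x
    using L(2)[of "x - a"] that by (simp add: U_iff g_def linear_diff[OF L(1)] algebra_simps)
  with L(1) show ?thesis using that by blast
qed

text \<open>A kernel vector, scaled to be short enough, can be added to an interior point without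
  leaving \<open>K\<close> and without changing the value of \<open>L\<close>, so it must
  vanish.\<close>

lemma linear_injI_interior:
  fixes L :: "'a::real_normed_vector \<Rightarrow> 'b::real_vector"
  assumes "linear L" "interior K \<noteq> {}" "inj_on L K"
  shows "inj L"
proof (rule linear_injective_0[OF assms(1), THEN iffD2], intro allI impI)
  fix v assume v: "L v = 0"
  obtain a r where r: "r > 0" "ball a r \<subseteq> K"
    using assms(2) by (auto simp: mem_interior)
  define s where "s = r / (1 + norm v)"
  have s: "s > 0" using r by (simp add: s_def add_pos_nonneg)
  have "s * (1 + norm v) = r"
    by (simp add: s_def add_nonneg_eq_0_iff)
  then have "s * norm v < r"
    using s by (simp add: distrib_left)
  then have "a + s *\<^sub>R v \<in> K"
    using r s by (auto simp: subset_iff dist_norm)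
  moreover have "a \<in> K" using r by auto
  moreover have "L (a + s *\<^sub>R v) = L a"
    using v by (simp add: linear_add[OF assms(1)] linear_scale[OF assms(1)])
  ultimately have "a + s *\<^sub>R v = a"
    using assms(3) by (meson inj_onD)
  with s show "v = 0" by simp
qed

text \<open>Every short vector is a difference of two points of a ball in \<open>S\<close>. In such
  a difference \<open>c\<close> cancels, so the vector lies in the range of \<open>L\<close>, and
  rescaling reaches every \<open>y\<close>.\<close>

lemma linear_surjI_interior:
  fixes L :: "'a::real_vector \<Rightarrow> 'b::real_normed_vector"
  assumes "linear L" "interior S \<noteq> {}" "S \<subseteq> (\<lambda>x. L x + c) ` UNIV"
  shows "surj L"
proof -
  have "y \<in> range L" for y
  proof -
    obtain b r where r: "r > 0" "ball b r \<subseteq> S"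
      using assms(2) by (auto simp: mem_interior)
    define s where "s = r / (1 + norm y)"
    have s: "s > 0" using r by (simp add: s_def add_pos_nonneg)
    have "s * (1 + norm y) = r"
      by (simp add: s_def add_nonneg_eq_0_iff)
    then have "s * norm y < r"
      using s by (simp add: distrib_left)
    then have "b + s *\<^sub>R y \<in> S" "b \<in> S"
      using r s by (auto simp: subset_iff dist_norm)
    then obtain u v where "b + s *\<^sub>R y = L u + c" "b = L v + c"
      using assms(3) by blast
    then have "L (u - v) = s *\<^sub>R y"
      by (simp add: linear_diff[OF assms(1)] algebra_simps)
    then have "y = L ((1 / s) *\<^sub>R (u - v))"
      using s by (simp add: linear_scale[OF assms(1)])
    then show ?thesis by blast
  qed
  then show ?thesis by auto
qed

lemma bij_plus_const_iff: "bij (\<lambda>x. L x + c) \<longleftrightarrow> bij L" for L :: "'a \<Rightarrow> 'b::group_add"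
proof -
  have "bij ((\<lambda>y. y + c) \<circ> L) \<longleftrightarrow> bij L"
    by (rule bij_betw_comp_iff2[symmetric]) (auto intro: bij_plus_right)
  then show ?thesis by (simp add: o_def)
qed

lemma bij_linear_CARD_eq:
  fixes L :: "real ^ 'm \<Rightarrow> real ^ 'n"
  assumes "linear L" "bij L"
  shows "CARD('m) = CARD('n)"
proof -
  have "inj L" "surj L" using assms(2) by (auto simp: bij_def)
  then have "dim (UNIV :: (real ^ 'n) set) = dim (UNIV :: (real ^ 'm) set)"
    using dim_image_eq[OF assms(1), of UNIV] by simp
  then show ?thesis by simp
qed

lemma affine_bijection_aff_isomorphism:
  assumes F: "affine_bijection F" "F ` K = K'" and f: "\<And>x. x \<in> K \<Longrightarrow> f x = F x"
    and "convex K"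
  shows "aff_isomorphism (convex_structure K) (convex_structure K') f"
proof -
  obtain L c where L: "linear L" "\<And>x. F x = L x + c" and "bij F"
    using F(1) by (auto simp: affine_bijection_def)
  then have inj: "inj F" by (simp add: bij_is_inj)
  have comb: "F ((1 - l) *\<^sub>R p + l *\<^sub>R q) = (1 - l) *\<^sub>R F p + l *\<^sub>R F q" for l p q
    by (simp add: L linear_add[OF L(1)] linear_diff[OF L(1)] linear_scale[OF L(1)] algebra_simps)
  \<comment> \<open>Segments are sets of convex combinations, which \<open>F\<close> carries over
    with the same weight; injectivity of \<open>F\<close> gives the way back.\<close>
  have "x \<in> closed_segment a b \<longleftrightarrow> F x \<in> closed_segment (F a) (F b)" for a x b
    by (simp only: in_segment comb[symmetric] inj_eq[OF inj])
  moreover have "bij_betw f K K'"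
    using bij_betw_subset[OF \<open>bij F\<close> subset_UNIV F(2)] bij_betw_cong[of K f F K'] f by blast
  \<comment> \<open>Convexity keeps combinations inside \<open>K\<close>, the only place where
    \<open>f\<close> is known to agree with \<open>F\<close>.\<close>
  moreover have "(1 - l) *\<^sub>R p + l *\<^sub>R q \<in> K" if "0 \<le> l" "l \<le> 1" "p \<in> K" "q \<in> K" for l p q
    using \<open>convex K\<close> that by (auto simp: convex_alt)
  ultimately show ?thesis
    by (auto simp: aff_isomorphism_def convex_structure_def f comb)
qed

text \<open>The interior of \<open>K\<close> supplies the affine formula and the injectivity of its
  linear part, the interior of \<open>K'\<close> the surjectivity. A bijective linear part then
  forces equal dimensions.\<close>

lemma aff_isomorphism_affine_bijection:
  fixes f :: "real ^ 'm \<Rightarrow> real ^ 'n"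
  assumes f: "aff_isomorphism (convex_structure K) (convex_structure K') f"
    and "interior K \<noteq> {}" "interior K' \<noteq> {}"
  obtains F :: "real ^ 'm \<Rightarrow> real ^ 'n"
  where "CARD('m) = CARD('n)" "affine_bijection F" "F ` K = K'" "\<And>x. x \<in> K \<Longrightarrow> f x = F x"
proof -
  have bij: "bij_betw f K K'"
    and comb: "\<And>l p q. 0 \<le> l \<Longrightarrow> l \<le> 1 \<Longrightarrow> p \<in> K \<Longrightarrow> q \<in> K \<Longrightarrow>
      f ((1 - l) *\<^sub>R p + l *\<^sub>R q) = (1 - l) *\<^sub>R f p + l *\<^sub>R f q"
    using f by (auto simp: aff_isomorphism_def convex_structure_def)
  obtain L c where L: "linear L" "\<And>x. x \<in> K \<Longrightarrow> f x = L x + c"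
    using convex_combination_map_affine[where f = f, OF assms(2) comb] by blast
  have image: "(\<lambda>x. L x + c) ` K = K'"
    using bij L(2) by (auto simp: bij_betw_def)
  have "inj_on L K"
    using bij L(2) by (auto simp: bij_betw_def inj_on_def)
  then have "inj L"
    using linear_injI_interior L(1) assms(2) by blast
  moreover have "surj L"
    using linear_surjI_interior[OF L(1) assms(3), of c] image by blast
  ultimately have "bij L" by (simp add: bij_def)
  with L(1) have "affine_bijection (\<lambda>x. L x + c)"
    unfolding affine_bijection_def bij_plus_const_iff by blast
  then show ?thesis
    using that bij_linear_CARD_eq[OF L(1) \<open>bij L\<close>] image L(2) by blast
qed

theorem theorem3p1:
  fixes K :: "(real ^ 'm) set" and K' :: "(real ^ 'n) set"
  assumes "CARD('m) \<ge> 2" and "CARD('n) \<ge> 2"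
    and "convex K" and "interior K \<noteq> {}"
    and "convex K'" and "interior K' \<noteq> {}"
  shows "(\<forall>f :: real ^ 'm \<Rightarrow> real ^ 'n. f ` K \<subseteq> K' \<longrightarrow>
            (aff_isomorphism (convex_structure K) (convex_structure K') f \<longleftrightarrow>
               CARD('m) = CARD('n) \<and>
               (\<exists>F :: real ^ 'm \<Rightarrow> real ^ 'n.
                  affine_bijection F \<and> F ` K = K' \<and> (\<forall>x\<in>K. f x = F x)))) \<and>
         (aff_isomorphic (convex_structure K) (convex_structure K') \<longleftrightarrow>
            affinely_equivalent K K')"
proof -
  have iff: "aff_isomorphism (convex_structure K) (convex_structure K') f \<longleftrightarrow>
      CARD('m) = CARD('n) \<and>
      (\<exists>F :: real ^ 'm \<Rightarrow> real ^ 'n.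
         affine_bijection F \<and> F ` K = K' \<and> (\<forall>x\<in>K. f x = F x))"
    for f :: "real ^ 'm \<Rightarrow> real ^ 'n"
  proof
    assume "aff_isomorphism (convex_structure K) (convex_structure K') f"
    from aff_isomorphism_affine_bijection[OF this assms(4,6)]
    show "CARD('m) = CARD('n) \<and>
      (\<exists>F :: real ^ 'm \<Rightarrow> real ^ 'n.
         affine_bijection F \<and> F ` K = K' \<and> (\<forall>x\<in>K. f x = F x))"
      by metis
  qed (use affine_bijection_aff_isomorphism \<open>convex K\<close> in blast)
  \<comment> \<open>For isomorphism as a relation, an isomorphism yields its extension
    \<open>F\<close>; conversely \<open>F\<close> itself serves as the isomorphism.\<close>
  then show ?thesis
    unfolding aff_isomorphic_def affinely_equivalent_def by blast
qed

end
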